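(* The functor $Ext_g$ from the category $\mathbf{Graded\ Fuzzy\ TopSys}$ to the category $\mathbf{Graded\ Fuzzy\ Top}$, given by $Ext_g(X,\models,A,R)=(X,ext_g(A),\subseteq)$ and $Ext_g(f_1,f_2)=f_1$, is right adjoint to the functor $J_g$ from $\mathbf{Graded\ Fuzzy\ Top}$ to $\mathbf{Graded\ Fuzzy\ TopSys}$, given by $J_g(X,\tau,\subseteq)=(X,\in,\tau,\subseteq)$ and $J_g(f)=(f,f^{-1})$.
   Context: Gödel arrow on $[0,1]$: $a\to b=1$ if $a\le b$, $a\to b=b$ if $a>b$. In $[0,1]$, $\wedge$ is minimum. $\mathbf{Graded\ Fuzzy\ Top}$: objects are fuzzy topological spaces with graded inclusion $(X,\tau,\subseteq)$, where $X$ is a set, $\tau$ is a collection of maps $X\to[0,1]$ containing the constants $0$ and $1$ and closed under arbitrary pointwise suprema ($\bigcup$) and binary pointwise minima ($\cap$), and $\subseteq$ is the fuzzy relation $gr(\tilde T_1\subseteq\tilde T_2)=\inf_{x\in X}\{\tilde T_1(x)\to\tilde T_2(x)\}$. A morphism $(X,\tau,\subseteq)\to(Y,\tau',\subseteq)$ is a function $f:X\to Y$ with $f^{-1}(\tilde T'):=\tilde T'\circ f\in\tau$ for all $\tilde T'\in\tau'$. A graded frame $(A,R)$ is a 5-tuple $(A,\top,\wedge,\bigvee,R)$ with $A$ a non-empty set, $\top\in A$, $\wedge$ a binary operation, $\bigvee$ an operation on arbitrary subsets of $A$, and $R:A\times A\to[0,1]$ such that for all $a,b,c\in A$, $S\subseteq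 A$: (1) $R(a,a)=1$; (2) $R(a,b)=1=R(b,a)$ implies $a=b$; (3) $R(a,b)\wedge R(b,c)\le R(a,c)$; (4) $R(a\wedge b,a)=1=R(a\wedge b,b)$; (5) $R(a,\top)=1$; (6) $R(a,b)\wedge R(a,c)=R(a,b\wedge c)$; (7) $R(a,\bigvee S)=1$ if $a\in S$; (8) $\inf\{R(a,b)\mid a\in S\}=R(\bigvee S,b)$; (9) $R(a\wedge\bigvee S,\bigvee\{a\wedge b\mid b\in S\})=1$. A graded frame homomorphism $f:(A,R)\to(B,R')$ is a map with $f(a_1\wedge a_2)=f(a_1)\wedge f(a_2)$, $f(\bigvee_i a_i)=\bigvee_i f(a_i)$ and $R(a_1,a_2)\le R'(f(a_1),f(a_2))$. $\mathbf{Graded\ Fuzzy\ TopSys}$: objects are graded fuzzy topological systems $(X,\models,A,R)$, with $X$ a non-empty set, $(A,R)$ a graded frame and $\models$ a function $(x,a)\mapsto gr(x\models a)\in[0,1]$ such that (1) $gr(x\models a)\wedge R(a,b)\le gr(x\models b)$; (2) $gr(x\models\bigwedge S)=\inf\{gr(x\models a)\mid a\in S\}$ for finite $S\subseteq A$, including $S=\emptyset$ (where $\bigwedge\emptyset=\top$, $\inf\emptyset=1$); (3) $gr(x\models\bigvee S)=\sup\{gr(x\models a)\mid a\in S\}$ for every $S\subseteq A$ (with $\sup\emptyset=0$). A morphism $(X,\models,A,R)\to(Y,\models',B,R')$ is a pair $(f_1,f_2)$ with $f_1:X\to Y$ a function, $f_2:(B,R')\to(A,R)$ a graded frame homomorphism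 and $gr(x\models f_2(b))=gr(f_1(x)\models'b)$ for all $x\in X,b\in B$. Composition is $(g_1,g_2)\circ(f_1,f_2)=(g_1\circ f_1,f_2\circ g_2)$. $ext_g(a):X\to[0,1]$ is $ext_g(a)(x)=gr(x\models a)$, and $ext_g(A)=\{ext_g(a):a\in A\}$. In $(X,\in,\tau,\subseteq)$, $gr(x\in\tilde T)=\tilde T(x)$, and $(\tau,\subseteq)$ is a graded frame with operations $\cap,\bigcup$ and top the constant $1$.
   Formalization: Systems must have a non-empty point set but spaces need not, so J_g is undefined on the empty space; the adjunction is proved both for non-empty spaces with systems as defined, and for all spaces with systems also allowed an empty point set. *)

theory Defs
  imports Complex_Main "HOL-Library.FuncSet"
begin

section \<open>Categories, functors and adjunctions\<close>

text \<open>Arrows are given by hom-sets. Two hom-sets need not be disjoint, so identities, composition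
  and the action of a functor on arrows carry the objects involved as arguments:
  \<open>Comp C X Y Z g f\<close> is the composite of \<open>f : X \<rightarrow> Y\<close> and \<open>g : Y \<rightarrow> Z\<close>.\<close>

record ('o, 'm) cat =
  Ob :: "'o set"
  Hom :: "'o \<Rightarrow> 'o \<Rightarrow> 'm set"
  Id :: "'o \<Rightarrow> 'm"
  Comp :: "'o \<Rightarrow> 'o \<Rightarrow> 'o \<Rightarrow> 'm \<Rightarrow> 'm \<Rightarrow> 'm"

locale category =
  fixes C :: "('o, 'm) cat"
  assumes Id_in_Hom: "X \<in> Ob C \<Longrightarrow> Id C X \<in> Hom C X X"
    and Comp_in_Hom:
      "\<lbrakk>X \<in> Ob C; Y \<in> Ob C; Z \<in> Ob C; f \<in> Hom C X Y; g \<in> Hom C Y Z\<rbrakk>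
        \<Longrightarrow> Comp C X Y Z g f \<in> Hom C X Z"
    and Comp_Id_right:
      "\<lbrakk>X \<in> Ob C; Y \<in> Ob C; f \<in> Hom C X Y\<rbrakk> \<Longrightarrow> Comp C X X Y f (Id C X) = f"
    and Comp_Id_left:
      "\<lbrakk>X \<in> Ob C; Y \<in> Ob C; f \<in> Hom C X Y\<rbrakk> \<Longrightarrow> Comp C X Y Y (Id C Y) f = f"
    and Comp_assoc:
      "\<lbrakk>W \<in> Ob C; X \<in> Ob C; Y \<in> Ob C; Z \<in> Ob C;
        f \<in> Hom C W X; g \<in> Hom C X Y; h \<in> Hom C Y Z\<rbrakk>
        \<Longrightarrow> Comp C W Y Z h (Comp C W X Y g f) = Comp C W X Z (Comp C X Y Z h g) f"

record ('o1, 'm1, 'o2, 'm2) func =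
  obj :: "'o1 \<Rightarrow> 'o2"
  arr :: "'o1 \<Rightarrow> 'o1 \<Rightarrow> 'm1 \<Rightarrow> 'm2"

locale is_functor = C: category C + D: category D
  for C :: "('o1, 'm1) cat" and D :: "('o2, 'm2) cat" +
  fixes F :: "('o1, 'm1, 'o2, 'm2) func"
  assumes obj_in_Ob: "X \<in> Ob C \<Longrightarrow> obj F X \<in> Ob D"
    and arr_in_Hom:
      "\<lbrakk>X \<in> Ob C; Y \<in> Ob C; f \<in> Hom C X Y\<rbrakk> \<Longrightarrow> arr F X Y f \<in> Hom D (obj F X) (obj F Y)"
    and arr_Id: "X \<in> Ob C \<Longrightarrow> arr F X X (Id C X) = Id D (obj F X)"
    and arr_Comp:
      "\<lbrakk>X \<in> Ob C; Y \<in> Ob C; Z \<in> Ob C; f \<in> Hom C X Y; g \<in> Hom C Y Z\<rbrakk>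
        \<Longrightarrow> arr F X Z (Comp C X Y Z g f)
          = Comp D (obj F X) (obj F Y) (obj F Z) (arr F Y Z g) (arr F X Y f)"

text \<open>An adjunction between \<open>F : C \<rightarrow> D\<close> (left adjoint) and \<open>G : D \<rightarrow> C\<close> (right adjoint): bijections
  \<open>\<phi> X Y\<close> from \<open>Hom D (F X) Y\<close> to \<open>Hom C X (G Y)\<close>, natural in \<open>X\<close> and in \<open>Y\<close>.\<close>

locale adjunction = F: is_functor C D F + G: is_functor D C G
  for C :: "('o1, 'm1) cat" and D :: "('o2, 'm2) cat"
    and F :: "('o1, 'm1, 'o2, 'm2) func" and G :: "('o2, 'm2, 'o1, 'm1) func" +
  fixes \<phi> :: "'o1 \<Rightarrow> 'o2 \<Rightarrow> 'm2 \<Rightarrow> 'm1"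
  assumes bij:
      "\<lbrakk>X \<in> Ob C; Y \<in> Ob D\<rbrakk> \<Longrightarrow> bij_betw (\<phi> X Y) (Hom D (obj F X) Y) (Hom C X (obj G Y))"
    and natural_left:
      "\<lbrakk>X' \<in> Ob C; X \<in> Ob C; Y \<in> Ob D; h \<in> Hom C X' X; g \<in> Hom D (obj F X) Y\<rbrakk>
        \<Longrightarrow> \<phi> X' Y (Comp D (obj F X') (obj F X) Y g (arr F X' X h))
          = Comp C X' X (obj G Y) (\<phi> X Y g) h"
    and natural_right:
      "\<lbrakk>X \<in> Ob C; Y \<in> Ob D; Y' \<in> Ob D; g \<in> Hom D (obj F X) Y; k \<in> Hom D Y Y'\<rbrakk>
        \<Longrightarrow> \<phi> X Y' (Comp D (obj F X) Y Y' k g)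
          = Comp C X (obj G Y) (obj G Y') (arr G Y Y' k) (\<phi> X Y g)"

definition right_adjoint ::
  "('o1, 'm1) cat \<Rightarrow> ('o2, 'm2) cat \<Rightarrow> ('o1, 'm1, 'o2, 'm2) func
    \<Rightarrow> ('o2, 'm2, 'o1, 'm1) func \<Rightarrow> bool" where
  "right_adjoint C D F G \<longleftrightarrow> (\<exists>\<phi>. adjunction C D F G \<phi>)"

section \<open>The unit interval\<close>

text \<open>Suprema and infima taken in \<open>{0..1}\<close>. Inserting the bottom (top) element changes nothing for
  nonempty subsets of the unit interval, and gives the right value for the empty set.\<close>

definition sup01 :: "real set \<Rightarrow> real" where
  "sup01 V = Sup (insert 0 V)"

definition inf01 :: "real set \<Rightarrow> real" where
  "inf01 V = Inf (insert 1 V)"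

definition goedel_imp :: "real \<Rightarrow> real \<Rightarrow> real" where
  "goedel_imp a b = (if a \<le> b then 1 else b)"

section \<open>Fuzzy topological spaces with graded inclusion\<close>

text \<open>A fuzzy subset of \<open>X\<close> is a function in \<open>X \<rightarrow>\<^sub>E {0..1}\<close>, so that fuzzy subsets which agree
  on \<open>X\<close> are equal. The graded inclusion of a space is determined by its point set and is therefore
  not stored.\<close>

record 'x fspace =
  points :: "'x set"
  opens :: "('x \<Rightarrow> real) set"

definition fuzzy_const :: "'x set \<Rightarrow> real \<Rightarrow> 'x \<Rightarrow> real" where
  "fuzzy_const X c = (\<lambda>x\<in>X. c)"

definition fuzzy_Int :: "'x set \<Rightarrow> ('x \<Rightarrow> real) \<Rightarrow> ('x \<Rightarrow> real) \<Rightarrow> 'x \<Rightarrow> real" where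
  "fuzzy_Int X T1 T2 = (\<lambda>x\<in>X. min (T1 x) (T2 x))"

definition fuzzy_Union :: "'x set \<Rightarrow> ('x \<Rightarrow> real) set \<Rightarrow> 'x \<Rightarrow> real" where
  "fuzzy_Union X \<T> = (\<lambda>x\<in>X. sup01 ((\<lambda>T. T x) ` \<T>))"

definition graded_incl :: "'x set \<Rightarrow> ('x \<Rightarrow> real) \<Rightarrow> ('x \<Rightarrow> real) \<Rightarrow> real" where
  "graded_incl X T1 T2 = inf01 ((\<lambda>x. goedel_imp (T1 x) (T2 x)) ` X)"

definition preimg :: "'x set \<Rightarrow> ('x \<Rightarrow> 'y) \<Rightarrow> ('y \<Rightarrow> real) \<Rightarrow> 'x \<Rightarrow> real" where
  "preimg X f T = (\<lambda>x\<in>X. T (f x))"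

definition fuzzy_space :: "'x fspace \<Rightarrow> bool" where
  "fuzzy_space T \<longleftrightarrow>
    opens T \<subseteq> (points T \<rightarrow>\<^sub>E {0..1}) \<and>
    fuzzy_const (points T) 0 \<in> opens T \<and>
    fuzzy_const (points T) 1 \<in> opens T \<and>
    (\<forall>T1\<in>opens T. \<forall>T2\<in>opens T. fuzzy_Int (points T) T1 T2 \<in> opens T) \<and>
    (\<forall>\<T>\<subseteq>opens T. fuzzy_Union (points T) \<T> \<in> opens T)"

definition fuzzy_continuous :: "'x fspace \<Rightarrow> 'x fspace \<Rightarrow> ('x \<Rightarrow> 'x) set" where
  "fuzzy_continuous S T =
    {f \<in> points S \<rightarrow>\<^sub>E points T. \<forall>V\<in>opens T. preimg (points S) f V \<in> opens S}"

definition top_cat :: "('x fspace \<Rightarrow> bool) \<Rightarrow> ('x fspace, 'x \<Rightarrow> 'x) cat" where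
  "top_cat P =
    \<lparr>Ob = {T. fuzzy_space T \<and> P T},
     Hom = fuzzy_continuous,
     Id = (\<lambda>T. \<lambda>x\<in>points T. x),
     Comp = (\<lambda>S T U g f. compose (points S) g f)\<rparr>"

section \<open>Graded frames\<close>

text \<open>Values of the operations outside the carrier are irrelevant.\<close>

record 'a gframe =
  car :: "'a set"
  tp :: 'a
  meet :: "'a \<Rightarrow> 'a \<Rightarrow> 'a"
  Join :: "'a set \<Rightarrow> 'a"
  rel :: "'a \<Rightarrow> 'a \<Rightarrow> real"

locale graded_frame =
  fixes A :: "'a gframe"
  assumes nonempty: "car A \<noteq> {}"
    and top_closed: "tp A \<in> car A"
    and meet_closed: "\<lbrakk>a \<in> car A; b \<in> car A\<rbrakk> \<Longrightarrow> meet A a b \<in> car A"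
    and Join_closed: "S \<subseteq> car A \<Longrightarrow> Join A S \<in> car A"
    and rel_range: "\<lbrakk>a \<in> car A; b \<in> car A\<rbrakk> \<Longrightarrow> rel A a b \<in> {0..1}"
    and rel_refl: "a \<in> car A \<Longrightarrow> rel A a a = 1"
    and rel_antisym:
      "\<lbrakk>a \<in> car A; b \<in> car A; rel A a b = 1; rel A b a = 1\<rbrakk> \<Longrightarrow> a = b"
    and rel_trans:
      "\<lbrakk>a \<in> car A; b \<in> car A; c \<in> car A\<rbrakk> \<Longrightarrow> min (rel A a b) (rel A b c) \<le> rel A a c"
    and meet_lower1: "\<lbrakk>a \<in> car A; b \<in> car A\<rbrakk> \<Longrightarrow> rel A (meet A a b) a = 1"
    and meet_lower2: "\<lbrakk>a \<in> car A; b \<in> car A\<rbrakk> \<Longrightarrow> rel A (meet A a b) b = 1"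
    and rel_top: "a \<in> car A \<Longrightarrow> rel A a (tp A) = 1"
    and rel_meet:
      "\<lbrakk>a \<in> car A; b \<in> car A; c \<in> car A\<rbrakk>
        \<Longrightarrow> min (rel A a b) (rel A a c) = rel A a (meet A b c)"
    and Join_upper: "\<lbrakk>S \<subseteq> car A; a \<in> S\<rbrakk> \<Longrightarrow> rel A a (Join A S) = 1"
    and rel_Join:
      "\<lbrakk>S \<subseteq> car A; b \<in> car A\<rbrakk> \<Longrightarrow> inf01 {rel A a b |a. a \<in> S} = rel A (Join A S) b"
    and distrib:
      "\<lbrakk>a \<in> car A; S \<subseteq> car A\<rbrakk>
        \<Longrightarrow> rel A (meet A a (Join A S)) (Join A {meet A a b |b. b \<in> S}) = 1"

text \<open>Homomorphisms are not required to preserve the top element.\<close>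

definition gframe_hom :: "'a gframe \<Rightarrow> 'b gframe \<Rightarrow> ('a \<Rightarrow> 'b) set" where
  "gframe_hom A B =
    {f \<in> car A \<rightarrow>\<^sub>E car B.
      (\<forall>a1\<in>car A. \<forall>a2\<in>car A. f (meet A a1 a2) = meet B (f a1) (f a2)) \<and>
      (\<forall>S\<subseteq>car A. f (Join A S) = Join B (f ` S)) \<and>
      (\<forall>a1\<in>car A. \<forall>a2\<in>car A. rel A a1 a2 \<le> rel B (f a1) (f a2))}"

text \<open>The meet of a finite subset of the carrier; \<^term>\<open>Finite_Set.fold\<close> is well defined here because
  the binary meet of a graded frame is associative and commutative on the carrier.\<close>

definition Meet_fin :: "'a gframe \<Rightarrow> 'a set \<Rightarrow> 'a" where
  "Meet_fin A S = Finite_Set.fold (meet A) (tp A) S"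

section \<open>Graded fuzzy topological systems\<close>

record ('x, 'a) gsystem =
  spoints :: "'x set"
  sat :: "'x \<Rightarrow> 'a \<Rightarrow> real"
  frm :: "'a gframe"

text \<open>All conditions on a graded fuzzy topological system except that there is at least one point,
  which is imposed by the choice of objects of the category.\<close>

definition gsystem_laws :: "('x, 'a) gsystem \<Rightarrow> bool" where
  "gsystem_laws Q \<longleftrightarrow>
    graded_frame (frm Q) \<and>
    (\<forall>x\<in>spoints Q. \<forall>a\<in>car (frm Q). sat Q x a \<in> {0..1}) \<and>
    (\<forall>x\<in>spoints Q. \<forall>a\<in>car (frm Q). \<forall>b\<in>car (frm Q).
      min (sat Q x a) (rel (frm Q) a b) \<le> sat Q x b) \<and>
    (\<forall>x\<in>spoints Q. \<forall>S\<subseteq>car (frm Q). finite S \<longrightarrow>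
      sat Q x (Meet_fin (frm Q) S) = inf01 {sat Q x a |a. a \<in> S}) \<and>
    (\<forall>x\<in>spoints Q. \<forall>S\<subseteq>car (frm Q).
      sat Q x (Join (frm Q) S) = sup01 {sat Q x a |a. a \<in> S})"

definition gsystem_hom ::
  "('x, 'a) gsystem \<Rightarrow> ('x, 'a) gsystem \<Rightarrow> (('x \<Rightarrow> 'x) \<times> ('a \<Rightarrow> 'a)) set" where
  "gsystem_hom P Q =
    {(f1, f2). f1 \<in> spoints P \<rightarrow>\<^sub>E spoints Q \<and> f2 \<in> gframe_hom (frm Q) (frm P) \<and>
      (\<forall>x\<in>spoints P. \<forall>b\<in>car (frm Q). sat P x (f2 b) = sat Q (f1 x) b)}"

definition topsys_cat ::
  "(('x, 'a) gsystem \<Rightarrow> bool) \<Rightarrow> (('x, 'a) gsystem, ('x \<Rightarrow> 'x) \<times> ('a \<Rightarrow> 'a)) cat" where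
  "topsys_cat P =
    \<lparr>Ob = {Q. gsystem_laws Q \<and> P Q},
     Hom = gsystem_hom,
     Id = (\<lambda>Q. (\<lambda>x\<in>spoints Q. x, \<lambda>a\<in>car (frm Q). a)),
     Comp = (\<lambda>P Q R g f.
       (compose (spoints P) (fst g) (fst f), compose (car (frm R)) (snd f) (snd g)))\<rparr>"

section \<open>The four categories\<close>

text \<open>A system has a nonempty point set while the point set of a space is arbitrary, so the empty
  space has no associated system. There are two ways to match the objects: leave out the empty
  space, or also admit systems without points.\<close>

definition Graded_Fuzzy_Top :: "('x fspace, 'x \<Rightarrow> 'x) cat" where
  "Graded_Fuzzy_Top = top_cat (\<lambda>_. True)"

definition Graded_Fuzzy_Top_nonempty :: "('x fspace, 'x \<Rightarrow> 'x) cat" where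
  "Graded_Fuzzy_Top_nonempty = top_cat (\<lambda>T. points T \<noteq> {})"

definition Graded_Fuzzy_TopSys ::
  "(('x, 'a) gsystem, ('x \<Rightarrow> 'x) \<times> ('a \<Rightarrow> 'a)) cat" where
  "Graded_Fuzzy_TopSys = topsys_cat (\<lambda>Q. spoints Q \<noteq> {})"

definition Graded_Fuzzy_TopSys_with_empty ::
  "(('x, 'a) gsystem, ('x \<Rightarrow> 'x) \<times> ('a \<Rightarrow> 'a)) cat" where
  "Graded_Fuzzy_TopSys_with_empty = topsys_cat (\<lambda>_. True)"

section \<open>The functors\<close>

definition ext :: "('x, 'a) gsystem \<Rightarrow> 'a \<Rightarrow> 'x \<Rightarrow> real" where
  "ext Q a = (\<lambda>x\<in>spoints Q. sat Q x a)"

definition Ext_g ::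
  "(('x, 'a) gsystem, ('x \<Rightarrow> 'x) \<times> ('a \<Rightarrow> 'a), 'x fspace, 'x \<Rightarrow> 'x) func" where
  "Ext_g =
    \<lparr>obj = (\<lambda>Q. \<lparr>points = spoints Q, opens = ext Q ` car (frm Q)\<rparr>),
     arr = (\<lambda>P Q f. fst f)\<rparr>"

definition open_system :: "'x fspace \<Rightarrow> ('x, 'x \<Rightarrow> real) gsystem" where
  "open_system T =
    \<lparr>spoints = points T,
     sat = (\<lambda>x V. V x),
     frm =
       \<lparr>car = opens T,
        tp = fuzzy_const (points T) 1,
        meet = fuzzy_Int (points T),
        Join = fuzzy_Union (points T),
        rel = graded_incl (points T)\<rparr>\<rparr>"

text \<open>In \<^term>\<open>open_system T\<close> the elements of the frame have type \<open>'x \<Rightarrow> real\<close>. To let the frames of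
  systems live in an arbitrary type \<open>'a\<close> that is large enough, the frame is renamed along an injection
  \<open>e\<close> from \<open>'x \<Rightarrow> real\<close> to \<open>'a\<close>; for \<open>e = id\<close> nothing is renamed.\<close>

definition rename_frame :: "('b \<Rightarrow> 'a) \<Rightarrow> ('x, 'b) gsystem \<Rightarrow> ('x, 'a) gsystem" where
  "rename_frame e Q =
    \<lparr>spoints = spoints Q,
     sat = (\<lambda>x a. sat Q x (inv e a)),
     frm =
       \<lparr>car = e ` car (frm Q),
        tp = e (tp (frm Q)),
        meet = (\<lambda>a b. e (meet (frm Q) (inv e a) (inv e b))),
        Join = (\<lambda>S. e (Join (frm Q) (inv e ` S))),
        rel = (\<lambda>a b. rel (frm Q) (inv e a) (inv e b))\<rparr>\<rparr>"

definition J_g ::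
  "(('x \<Rightarrow> real) \<Rightarrow> 'a)
    \<Rightarrow> ('x fspace, 'x \<Rightarrow> 'x, ('x, 'a) gsystem, ('x \<Rightarrow> 'x) \<times> ('a \<Rightarrow> 'a)) func" where
  "J_g e =
    \<lparr>obj = (\<lambda>T. rename_frame e (open_system T)),
     arr = (\<lambda>S T f. (f, \<lambda>b\<in>e ` opens T. e (preimg (points S) f (inv e b))))\<rparr>"

lemma rename_frame_id: "rename_frame id Q = Q"
  by (cases Q, rename_tac X s A, case_tac A) (simp add: rename_frame_def)

lemma J_g_id:
  "J_g id = \<lparr>obj = open_system, arr = (\<lambda>S T f. (f, \<lambda>V\<in>opens T. preimg (points S) f V))\<rparr>"
  by (simp add: J_g_def rename_frame_id)

end

theory Submission
  imports Defs
begin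

text \<open>The hom-set bijection sends a morphism \<open>(f\<^sub>1, f\<^sub>2) : J\<^sub>g S \<rightarrow> Q\<close> to \<open>f\<^sub>1\<close>. It is injective because
  the elements of the frame of \<open>J\<^sub>g S\<close> are the fuzzy open sets of \<open>S\<close> themselves: the compatibility
  condition \<open>gr(x \<Turnstile> f\<^sub>2 b) = gr(f\<^sub>1 x \<Turnstile> b)\<close> says that the fuzzy set \<open>f\<^sub>2 b\<close> is the preimage under \<open>f\<^sub>1\<close> of
  the extent of \<open>b\<close> (\<open>hom_from_J_g_iff\<close>). The same formula shows which functions \<open>f\<^sub>1\<close> occur: the
  preimages of all extents have to be open, which is continuity into \<open>Ext\<^sub>g Q\<close>; and
  whenever they are open, \<open>b \<mapsto> f\<^sub>1\<^sup>-\<^sup>1(ext b)\<close> is automatically a graded frame homomorphism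
  (\<open>preimg_ext_gframe_hom\<close>). That is so because \<open>ext\<close> turns meets and joins into
  pointwise minima and suprema by the laws of a system, and because taking preimages is also
  pointwise. As the bijection is the first projection, naturality is immediate.

  What remains is that both functors are well defined, where the grades need care. The tool is the
  residuation property of the Goedel arrow: for \<open>c \<le> 1\<close>, \<open>c \<le> (a \<rightarrow> b)\<close> if and only if
  \<open>min a c \<le> b\<close>. Hence \<open>c \<le> gr(S \<subseteq> T)\<close> means \<open>min (S x) c \<le> T x\<close> at all points \<open>x\<close>
  (\<open>le_graded_incl_iff\<close>), and the graded frame axioms for fuzzy open sets, the axiom relating \<open>\<Turnstile>\<close> to
  \<open>R\<close>, and the monotonicity of \<open>ext\<close> all become pointwise
  statements about minima and suprema in \<open>[0,1]\<close>.

  Nonemptiness of the point set is respected by both functors, which do not change the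
  points. The proof is therefore carried out for an arbitrary property \<open>p\<close> of point sets, and the two
  versions of the adjunction are instances.\<close>

section \<open>Suprema, infima and residuation in the unit interval\<close>

lemma sup01_le_iff:
  assumes "V \<subseteq> {0..1}" "0 \<le> u"
  shows "sup01 V \<le> u \<longleftrightarrow> (\<forall>v\<in>V. v \<le> u)"
proof -
  have "bdd_above (insert 0 V)"
    using assms(1) by (intro bdd_aboveI[of _ 1]) auto
  then show ?thesis
    using assms(2) by (simp add: sup01_def cSup_le_iff)
qed

lemma le_inf01_iff:
  assumes "V \<subseteq> {0..1}" "l \<le> 1"
  shows "l \<le> inf01 V \<longleftrightarrow> (\<forall>v\<in>V. l \<le> v)"
proof -
  have "bdd_below (insert 1 V)"
    using assms(1) by (intro bdd_belowI[of _ 0]) auto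
  then show ?thesis
    using assms(2) by (simp add: inf01_def le_cInf_iff)
qed

lemma sup01_range: "V \<subseteq> {0..1} \<Longrightarrow> sup01 V \<in> {0..1}"
  unfolding sup01_def
  by (auto intro!: cSup_upper cSup_least bdd_aboveI[of _ 1])

lemma inf01_range: "V \<subseteq> {0..1} \<Longrightarrow> inf01 V \<in> {0..1}"
  unfolding inf01_def
  by (auto intro!: cInf_lower cInf_greatest bdd_belowI[of _ 0])

lemma sup01_upper: "V \<subseteq> {0..1} \<Longrightarrow> v \<in> V \<Longrightarrow> v \<le> sup01 V"
  using sup01_le_iff[of V "sup01 V"] sup01_range[of V] by auto

text \<open>Distributivity of the minimum over arbitrary suprema, in the form in which residuation asks
  for it.\<close>

lemma min_sup01_le_iff:
  assumes "V \<subseteq> {0..1}" "0 \<le> u"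
  shows "min (sup01 V) c \<le> u \<longleftrightarrow> (\<forall>v\<in>V. min v c \<le> u)"
  using sup01_le_iff[OF assms] by (auto simp: min_le_iff_disj)

text \<open>Used to turn equations between grades into equivalences of their lower bounds.\<close>

lemma eq_by_lower_bounds:
  fixes r s :: real
  assumes "r \<le> 1" "s \<le> 1" "\<And>c. c \<le> 1 \<Longrightarrow> c \<le> r \<longleftrightarrow> c \<le> s"
  shows "r = s"
  using assms(3)[of r] assms(3)[of s] assms(1,2) by simp

lemma le_goedel_imp_iff:
  assumes "c \<le> 1"
  shows "c \<le> goedel_imp a b \<longleftrightarrow> min a c \<le> b"
  using assms by (auto simp: goedel_imp_def min_le_iff_disj)

section \<open>Fuzzy sets and graded inclusion\<close>

abbreviation fuzzy_sets :: "'x set \<Rightarrow> ('x \<Rightarrow> real) set" where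
  "fuzzy_sets X \<equiv> X \<rightarrow>\<^sub>E {0..1}"

lemma fuzzy_set_eqI:
  "\<lbrakk>S \<in> fuzzy_sets X; T \<in> fuzzy_sets X; \<And>x. x \<in> X \<Longrightarrow> S x = T x\<rbrakk> \<Longrightarrow> S = T"
  by (rule PiE_ext)

lemma fuzzy_set_range: "T \<in> fuzzy_sets X \<Longrightarrow> x \<in> X \<Longrightarrow> 0 \<le> T x \<and> T x \<le> 1"
  by (auto dest: PiE_mem)

lemma fuzzy_sets_range: "\<T> \<subseteq> fuzzy_sets X \<Longrightarrow> x \<in> X \<Longrightarrow> (\<lambda>T. T x) ` \<T> \<subseteq> {0..1}"
  by (auto dest: PiE_mem)

lemma goedel_imp_image_range:
  "T \<in> fuzzy_sets X \<Longrightarrow> (\<lambda>x. goedel_imp (S x) (T x)) ` X \<subseteq> {0..1}"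
  by (auto simp: goedel_imp_def dest: fuzzy_set_range)

lemma graded_incl_range: "T \<in> fuzzy_sets X \<Longrightarrow> graded_incl X S T \<in> {0..1}"
  unfolding graded_incl_def by (intro inf01_range goedel_imp_image_range)

text \<open>Residuation at every point: the grade of an inclusion is at least \<open>c\<close> if cutting \<open>S\<close> off at
  height \<open>c\<close> gives an honest fuzzy subset of \<open>T\<close>.\<close>

lemma le_graded_incl_iff:
  assumes "T \<in> fuzzy_sets X" "c \<le> 1"
  shows "c \<le> graded_incl X S T \<longleftrightarrow> (\<forall>x\<in>X. min (S x) c \<le> T x)"
  using le_inf01_iff[OF goedel_imp_image_range[OF assms(1)] assms(2)]
    le_goedel_imp_iff[OF assms(2)]
  by (simp add: graded_incl_def)

lemma graded_incl_eq_1_iff: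
  assumes "S \<in> fuzzy_sets X" "T \<in> fuzzy_sets X"
  shows "graded_incl X S T = 1 \<longleftrightarrow> (\<forall>x\<in>X. S x \<le> T x)"
proof -
  have "graded_incl X S T = 1 \<longleftrightarrow> 1 \<le> graded_incl X S T"
    using graded_incl_range[OF assms(2)] by (auto intro: antisym)
  also have "\<dots> \<longleftrightarrow> (\<forall>x\<in>X. S x \<le> T x)"
    using le_graded_incl_iff[OF assms(2), of 1] fuzzy_set_range[OF assms(1)] by simp
  finally show ?thesis .
qed

lemma min_graded_incl_le:
  assumes "T \<in> fuzzy_sets X" "x \<in> X"
  shows "min (S x) (graded_incl X S T) \<le> T x"
  using le_graded_incl_iff[OF assms(1), of "graded_incl X S T" S]
    graded_incl_range[OF assms(1), of S] assms(2)
  by auto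

lemma fuzzy_Int_in:
  "S \<in> fuzzy_sets X \<Longrightarrow> T \<in> fuzzy_sets X \<Longrightarrow> fuzzy_Int X S T \<in> fuzzy_sets X"
  by (auto simp: fuzzy_Int_def min_def dest: fuzzy_set_range)

lemma preimg_in:
  "f \<in> X \<rightarrow>\<^sub>E Y \<Longrightarrow> T \<in> fuzzy_sets Y \<Longrightarrow> preimg X f T \<in> fuzzy_sets X"
  by (auto simp: preimg_def dest!: PiE_mem)

lemma preimg_Int:
  "f \<in> X \<rightarrow>\<^sub>E Y \<Longrightarrow> preimg X f (fuzzy_Int Y S T) = fuzzy_Int X (preimg X f S) (preimg X f T)"
  by (auto simp: preimg_def fuzzy_Int_def fun_eq_iff dest: PiE_mem)

lemma preimg_Union:
  "f \<in> X \<rightarrow>\<^sub>E Y \<Longrightarrow> preimg X f (fuzzy_Union Y \<T>) = fuzzy_Union X (preimg X f ` \<T>)"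
  by (auto simp: preimg_def fuzzy_Union_def fun_eq_iff image_image dest: PiE_mem)

lemma preimg_compose:
  "f \<in> X \<rightarrow>\<^sub>E Y \<Longrightarrow> preimg X (compose X g f) T = preimg X f (preimg Y g T)"
  by (auto simp: preimg_def fun_eq_iff compose_def dest: PiE_mem)

lemma preimg_id: "T \<in> fuzzy_sets X \<Longrightarrow> preimg X (\<lambda>x\<in>X. x) T = T"
  by (auto simp: preimg_def fun_eq_iff PiE_def extensional_def)

lemma fuzzy_spaceD:
  assumes "fuzzy_space T"
  shows "V \<in> opens T \<Longrightarrow> V \<in> fuzzy_sets (points T)"
    and "fuzzy_const (points T) 1 \<in> opens T"
    and "V \<in> opens T \<Longrightarrow> W \<in> opens T \<Longrightarrow> fuzzy_Int (points T) V W \<in> opens T"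
    and "\<T> \<subseteq> opens T \<Longrightarrow> fuzzy_Union (points T) \<T> \<in> opens T"
  using assms unfolding fuzzy_space_def by blast+

section \<open>Meets in graded frames\<close>

context graded_frame
begin

lemma rel_meet_1_iff:
  assumes "a \<in> car A" "b \<in> car A" "c \<in> car A"
  shows "rel A c (meet A a b) = 1 \<longleftrightarrow> rel A c a = 1 \<and> rel A c b = 1"
  using rel_meet[of c a b] rel_range[of c a] rel_range[of c b] assms
  by (auto simp: min_def split: if_splits)

text \<open>Both sides have the same lower bounds of grade 1.\<close>

lemma meet_left_commute:
  assumes "a \<in> car A" "b \<in> car A" "c \<in> car A"
  shows "meet A a (meet A b c) = meet A b (meet A a c)"
proof (rule rel_antisym)
  have below: "rel A (meet A a (meet A b c)) (meet A b (meet A a c)) = 1"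
    if "a \<in> car A" "b \<in> car A" "c \<in> car A" for a b c
  proof -
    have "rel A (meet A a (meet A b c)) a = 1"
      "rel A (meet A a (meet A b c)) b = 1" "rel A (meet A a (meet A b c)) c = 1"
      using that rel_meet_1_iff[of a "meet A b c" "meet A a (meet A b c)"]
        rel_meet_1_iff[of b c "meet A a (meet A b c)"] rel_refl
      by (simp_all add: meet_closed)
    then show ?thesis
      using that by (simp add: rel_meet_1_iff meet_closed)
  qed
  show "rel A (meet A a (meet A b c)) (meet A b (meet A a c)) = 1"
    "rel A (meet A b (meet A a c)) (meet A a (meet A b c)) = 1"
    using assms below by blast+
qed (use assms meet_closed in auto)

lemma meet_idem:
  assumes "a \<in> car A"
  shows "meet A a a = a"
  using assms by (intro rel_antisym) (auto simp: meet_closed meet_lower1 rel_meet_1_iff rel_refl)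

lemma meet_top:
  assumes "a \<in> car A"
  shows "meet A a (tp A) = a"
  using assms by (intro rel_antisym)
    (auto simp: meet_closed top_closed meet_lower1 rel_meet_1_iff rel_refl rel_top)

lemma Meet_fin_empty: "Meet_fin A {} = tp A"
  by (simp add: Meet_fin_def)

text \<open>The operation \<open>meet A\<close> is arbitrary outside the carrier, so it need not commute there as the
  fold laws demand. The fold never leaves the carrier, so it is unaffected if \<open>meet A\<close>
  is replaced, outside the carrier, by the second projection, and the resulting operation does
  commute.\<close>

lemma Meet_fin_insert:
  assumes "finite S" "S \<subseteq> car A" "a \<in> car A" "a \<notin> S"
  shows "Meet_fin A (insert a S) = meet A a (Meet_fin A S)"
    and "Meet_fin A S \<in> car A"
proof -
  define g where "g = (\<lambda>a b. if a \<in> car A \<and> b \<in> car A then meet A a b else b)"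
  have fold_g: "Meet_fin A S' = Finite_Set.fold g (tp A) S'" if "S' \<subseteq> car A" for S'
    unfolding Meet_fin_def
    by (rule fold_closed_eq[where B = "car A"])
      (use that in \<open>auto simp: g_def meet_closed top_closed\<close>)
  interpret g: comp_fun_commute_on "car A" g
    by unfold_locales (auto simp: g_def fun_eq_iff meet_closed meet_left_commute)
  have closed: "Finite_Set.fold g (tp A) S' \<in> car A" if "finite S'" "S' \<subseteq> car A" for S'
    using that
  proof (induction S')
    case (insert b S')
    then show ?case
      by (simp add: g.fold_insert) (simp add: g_def meet_closed)
  qed (simp add: top_closed)
  show "Meet_fin A S \<in> car A"
    using closed fold_g assms by simp
  show "Meet_fin A (insert a S) = meet A a (Meet_fin A S)"
    using assms closed[of S] by (simp add: fold_g g.fold_insert) (simp add: g_def)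
qed

end

section \<open>Laws of graded fuzzy topological systems\<close>

lemma inf01_insert:
  assumes "V \<subseteq> {0..1}" "v \<in> {0..1}"
  shows "inf01 (insert v V) = min v (inf01 V)"
  using assms inf01_range[of V] inf01_range[of "insert v V"]
  by (intro eq_by_lower_bounds) (auto simp: le_inf01_iff)

lemma inf01_empty: "inf01 {} = 1"
  by (simp add: inf01_def)

text \<open>Finite meets are inconvenient to verify directly; they reduce to the top element and binary
  meets.\<close>

lemma gsystem_lawsI:
  assumes "graded_frame (frm Q)"
    and sat_range: "\<And>x a. x \<in> spoints Q \<Longrightarrow> a \<in> car (frm Q) \<Longrightarrow> sat Q x a \<in> {0..1}"
    and "\<And>x a b. x \<in> spoints Q \<Longrightarrow> a \<in> car (frm Q) \<Longrightarrow> b \<in> car (frm Q)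
      \<Longrightarrow> min (sat Q x a) (rel (frm Q) a b) \<le> sat Q x b"
    and sat_top: "\<And>x. x \<in> spoints Q \<Longrightarrow> sat Q x (tp (frm Q)) = 1"
    and sat_meet: "\<And>x a b. x \<in> spoints Q \<Longrightarrow> a \<in> car (frm Q) \<Longrightarrow> b \<in> car (frm Q)
      \<Longrightarrow> sat Q x (meet (frm Q) a b) = min (sat Q x a) (sat Q x b)"
    and "\<And>x S. x \<in> spoints Q \<Longrightarrow> S \<subseteq> car (frm Q)
      \<Longrightarrow> sat Q x (Join (frm Q) S) = sup01 (sat Q x ` S)"
  shows "gsystem_laws Q"
proof -
  interpret graded_frame "frm Q" by fact
  have "sat Q x (Meet_fin (frm Q) S) = inf01 (sat Q x ` S)"
    if x: "x \<in> spoints Q" and "finite S" "S \<subseteq> car (frm Q)" for x S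
    using that(2,3)
  proof (induction S)
    case empty
    then show ?case
      using x by (simp add: Meet_fin_empty sat_top inf01_empty)
  next
    case (insert a S)
    moreover have "sat Q x ` S \<subseteq> {0..1}" "sat Q x a \<in> {0..1}"
      using insert.prems x sat_range by blast+
    ultimately show ?case
      using x Meet_fin_insert[of S a] by (simp add: sat_meet inf01_insert)
  qed
  with assms show ?thesis
    unfolding gsystem_laws_def Setcompr_eq_image Collect_mem_eq
    by (intro conjI ballI allI impI)
qed

lemma
  assumes "gsystem_laws Q"
  shows gsystem_frame: "graded_frame (frm Q)"
    and sat_range: "x \<in> spoints Q \<Longrightarrow> a \<in> car (frm Q) \<Longrightarrow> sat Q x a \<in> {0..1}"
    and sat_rel: "x \<in> spoints Q \<Longrightarrow> a \<in> car (frm Q) \<Longrightarrow> b \<in> car (frm Q)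
      \<Longrightarrow> min (sat Q x a) (rel (frm Q) a b) \<le> sat Q x b"
    and sat_Meet_fin: "x \<in> spoints Q \<Longrightarrow> S \<subseteq> car (frm Q) \<Longrightarrow> finite S
      \<Longrightarrow> sat Q x (Meet_fin (frm Q) S) = inf01 (sat Q x ` S)"
    and sat_Join: "x \<in> spoints Q \<Longrightarrow> S \<subseteq> car (frm Q)
      \<Longrightarrow> sat Q x (Join (frm Q) S) = sup01 (sat Q x ` S)"
  using assms unfolding gsystem_laws_def Setcompr_eq_image Collect_mem_eq by simp_all

lemma sat_top:
  assumes "gsystem_laws Q" "x \<in> spoints Q"
  shows "sat Q x (tp (frm Q)) = 1"
  using sat_Meet_fin[OF assms, of "{}"] graded_frame.Meet_fin_empty[OF gsystem_frame[OF assms(1)]]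
  by (simp add: inf01_empty)

lemma sat_meet:
  assumes Q: "gsystem_laws Q" "x \<in> spoints Q" and ab: "a \<in> car (frm Q)" "b \<in> car (frm Q)"
  shows "sat Q x (meet (frm Q) a b) = min (sat Q x a) (sat Q x b)"
proof (cases "a = b")
  case True
  then show ?thesis
    using ab graded_frame.meet_idem[OF gsystem_frame[OF Q(1)]] by simp
next
  case False
  interpret graded_frame "frm Q"
    using Q(1) by (rule gsystem_frame)
  have "Meet_fin (frm Q) {a, b} = meet (frm Q) a b"
    using False ab Meet_fin_insert(1)[of "{b}" a] Meet_fin_insert(1)[of "{}" b]
    by (simp add: Meet_fin_empty meet_top)
  moreover have "inf01 (sat Q x ` {a, b}) = min (sat Q x a) (sat Q x b)"
    using sat_range[OF Q, of a] sat_range[OF Q, of b] ab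
    by (simp add: inf01_insert inf01_empty)
  ultimately show ?thesis
    using sat_Meet_fin[OF Q, of "{a, b}"] ab by simp
qed

section \<open>The extent of a frame element\<close>

lemma ext_in: "gsystem_laws Q \<Longrightarrow> a \<in> car (frm Q) \<Longrightarrow> ext Q a \<in> fuzzy_sets (spoints Q)"
  unfolding ext_def by (intro restrict_PiE_iff[THEN iffD2] ballI sat_range)

lemma ext_meet:
  "\<lbrakk>gsystem_laws Q; a \<in> car (frm Q); b \<in> car (frm Q)\<rbrakk>
    \<Longrightarrow> ext Q (meet (frm Q) a b) = fuzzy_Int (spoints Q) (ext Q a) (ext Q b)"
  by (auto simp: ext_def fuzzy_Int_def sat_meet fun_eq_iff)

lemma ext_Join:
  "\<lbrakk>gsystem_laws Q; S \<subseteq> car (frm Q)\<rbrakk>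
    \<Longrightarrow> ext Q (Join (frm Q) S) = fuzzy_Union (spoints Q) (ext Q ` S)"
  by (auto simp: ext_def fuzzy_Union_def sat_Join fun_eq_iff image_image)

text \<open>The residuated form of the law \<open>gr(x \<Turnstile> a) \<and> R(a, b) \<le> gr(x \<Turnstile> b)\<close>.\<close>

lemma rel_le_graded_incl_ext:
  assumes Q: "gsystem_laws Q" and ab: "a \<in> car (frm Q)" "b \<in> car (frm Q)"
  shows "rel (frm Q) a b \<le> graded_incl (spoints Q) (ext Q a) (ext Q b)"
  using graded_frame.rel_range[OF gsystem_frame[OF Q] ab] sat_rel[OF Q _ ab]
  by (subst le_graded_incl_iff[OF ext_in[OF Q ab(2)]]) (auto simp: ext_def)

lemma graded_incl_le_preimg:
  assumes f: "f \<in> X \<rightarrow>\<^sub>E Y" and ST: "T \<in> fuzzy_sets Y"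
  shows "graded_incl Y S T \<le> graded_incl X (preimg X f S) (preimg X f T)"
proof -
  have "min (S (f x)) (graded_incl Y S T) \<le> T (f x)" if "x \<in> X" for x
    using min_graded_incl_le[OF ST] f that by (auto dest: PiE_mem)
  then show ?thesis
    using graded_incl_range[OF ST, of S]
    by (subst le_graded_incl_iff[OF preimg_in[OF f ST]]) (auto simp: preimg_def)
qed

lemma fuzzy_space_Ext:
  assumes Q: "gsystem_laws Q"
  shows "fuzzy_space \<lparr>points = spoints Q, opens = ext Q ` car (frm Q)\<rparr>"
proof -
  interpret graded_frame "frm Q"
    using Q by (rule gsystem_frame)
  let ?X = "spoints Q" and ?A = "car (frm Q)"
  have "fuzzy_const ?X 0 = ext Q (Join (frm Q) {})"
    by (auto simp: fuzzy_const_def ext_Join[OF Q] fuzzy_Union_def sup01_def)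
  moreover have "fuzzy_const ?X 1 = ext Q (tp (frm Q))"
    by (auto simp: fuzzy_const_def ext_def sat_top[OF Q] fun_eq_iff)
  moreover have "fuzzy_Int ?X V W \<in> ext Q ` ?A" if "V \<in> ext Q ` ?A" "W \<in> ext Q ` ?A" for V W
    using that by (auto simp: ext_meet[OF Q, symmetric] meet_closed)
  moreover have "fuzzy_Union ?X \<T> \<in> ext Q ` ?A" if "\<T> \<subseteq> ext Q ` ?A" for \<T>
  proof -
    from that obtain S where "S \<subseteq> ?A" "\<T> = ext Q ` S"
      by (meson subset_imageE)
    then show ?thesis
      by (simp add: ext_Join[OF Q, symmetric] Join_closed)
  qed
  moreover have "ext Q ` ?A \<subseteq> fuzzy_sets ?X"
    using ext_in[OF Q] by blast
  ultimately show ?thesis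
    by (simp add: fuzzy_space_def top_closed Join_closed)
qed

section \<open>The system of fuzzy open sets\<close>

lemma graded_incl_trans:
  assumes "V \<in> fuzzy_sets X" "W \<in> fuzzy_sets X"
  shows "min (graded_incl X U V) (graded_incl X V W) \<le> graded_incl X U W"
proof -
  have "min (U x) (min (graded_incl X U V) (graded_incl X V W)) \<le> W x" if x: "x \<in> X" for x
    using min_graded_incl_le[OF assms(1) x, of U] min_graded_incl_le[OF assms(2) x, of V]
    by linarith
  moreover have "min (graded_incl X U V) (graded_incl X V W) \<le> 1"
    using graded_incl_range[OF assms(1), of U] by auto
  ultimately show ?thesis
    using le_graded_incl_iff[OF assms(2)] by blast
qed

lemma graded_incl_Int:
  assumes V: "V \<in> fuzzy_sets X" and W: "W \<in> fuzzy_sets X"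
  shows "min (graded_incl X U V) (graded_incl X U W) = graded_incl X U (fuzzy_Int X V W)"
proof (rule eq_by_lower_bounds)
  note VW = fuzzy_Int_in[OF V W]
  show "min (graded_incl X U V) (graded_incl X U W) \<le> 1"
    "graded_incl X U (fuzzy_Int X V W) \<le> 1"
    using graded_incl_range[OF V, of U] graded_incl_range[OF VW, of U] by auto
  fix c :: real
  assume c: "c \<le> 1"
  have "(\<forall>x\<in>X. min (U x) c \<le> V x) \<and> (\<forall>x\<in>X. min (U x) c \<le> W x)
      \<longleftrightarrow> (\<forall>x\<in>X. min (U x) c \<le> fuzzy_Int X V W x)"
    by (auto simp only: fuzzy_Int_def restrict_apply' min.bounded_iff)
  then show "c \<le> min (graded_incl X U V) (graded_incl X U W)
      \<longleftrightarrow> c \<le> graded_incl X U (fuzzy_Int X V W)"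
    by (simp only: min.bounded_iff le_graded_incl_iff[OF V c] le_graded_incl_iff[OF W c]
        le_graded_incl_iff[OF VW c])
qed

lemma graded_incl_Union:
  assumes \<T>: "\<T> \<subseteq> fuzzy_sets X" and V: "V \<in> fuzzy_sets X"
  shows "inf01 {graded_incl X U V |U. U \<in> \<T>} = graded_incl X (fuzzy_Union X \<T>) V"
proof (rule eq_by_lower_bounds)
  have vals: "{graded_incl X U V |U. U \<in> \<T>} \<subseteq> {0..1}"
    using graded_incl_range[OF V] by auto
  show "inf01 {graded_incl X U V |U. U \<in> \<T>} \<le> 1"
    using inf01_range[OF vals] by simp
  show "graded_incl X (fuzzy_Union X \<T>) V \<le> 1"
    using graded_incl_range[OF V] by auto
  fix c :: real
  assume c: "c \<le> 1"
  have "c \<le> inf01 {graded_incl X U V |U. U \<in> \<T>} \<longleftrightarrow> (\<forall>U\<in>\<T>. \<forall>x\<in>X. min (U x) c \<le> V x)"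
    unfolding le_inf01_iff[OF vals c] le_graded_incl_iff[OF V c, symmetric] by blast
  also have "\<dots> \<longleftrightarrow> (\<forall>x\<in>X. \<forall>v\<in>(\<lambda>U. U x) ` \<T>. min v c \<le> V x)"
    by blast
  also have "\<dots> \<longleftrightarrow> (\<forall>x\<in>X. min (fuzzy_Union X \<T> x) c \<le> V x)"
  proof (rule ball_cong[OF refl])
    fix x
    assume x: "x \<in> X"
    show "(\<forall>v\<in>(\<lambda>U. U x) ` \<T>. min v c \<le> V x) \<longleftrightarrow> min (fuzzy_Union X \<T> x) c \<le> V x"
      using min_sup01_le_iff[OF fuzzy_sets_range[OF \<T> x], of "V x" c] fuzzy_set_range[OF V x] x
      by (simp add: fuzzy_Union_def)
  qed
  also have "\<dots> \<longleftrightarrow> c \<le> graded_incl X (fuzzy_Union X \<T>) V"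
    by (rule le_graded_incl_iff[OF V c, symmetric])
  finally show "c \<le> inf01 {graded_incl X U V |U. U \<in> \<T>}
      \<longleftrightarrow> c \<le> graded_incl X (fuzzy_Union X \<T>) V" .
qed

lemma fuzzy_Int_Union_le:
  assumes U: "U \<in> fuzzy_sets X" and \<T>: "\<T> \<subseteq> fuzzy_sets X" and x: "x \<in> X"
  shows "fuzzy_Int X U (fuzzy_Union X \<T>) x \<le> fuzzy_Union X {fuzzy_Int X U V |V. V \<in> \<T>} x"
proof -
  let ?W = "(\<lambda>V. V x) ` {fuzzy_Int X U V |V. V \<in> \<T>}"
  have "{fuzzy_Int X U V |V. V \<in> \<T>} \<subseteq> fuzzy_sets X"
    using fuzzy_Int_in[OF U] \<T> by blast
  then have W: "?W \<subseteq> {0..1}"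
    using x by (rule fuzzy_sets_range)
  have "min (V x) (U x) \<le> sup01 ?W" if "V \<in> \<T>" for V
  proof -
    have "fuzzy_Int X U V x \<in> ?W"
      using that by blast
    from sup01_upper[OF W this] show ?thesis
      using x by (simp add: fuzzy_Int_def min.commute)
  qed
  then have "min (sup01 ((\<lambda>V. V x) ` \<T>)) (U x) \<le> sup01 ?W"
    using min_sup01_le_iff[OF fuzzy_sets_range[OF \<T> x], of "sup01 ?W" "U x"] sup01_range[OF W]
    by simp
  then show ?thesis
    using x by (simp add: fuzzy_Int_def fuzzy_Union_def min.commute)
qed

lemma graded_frame_opens:
  assumes T: "fuzzy_space T"
  shows "graded_frame (frm (open_system T))"
proof -
  let ?X = "points T" and ?O = "opens T"
  have fs: "?O \<subseteq> fuzzy_sets ?X"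
    using fuzzy_spaceD(1)[OF T] by blast
  note fsD = subsetD[OF fs] and fs_sub = subset_trans[OF _ fs]
  note closed = fuzzy_spaceD(2-4)[OF T]
  have below: "graded_incl ?X U V = 1 \<longleftrightarrow> (\<forall>x\<in>?X. U x \<le> V x)" if "U \<in> ?O" "V \<in> ?O" for U V
    using that by (intro graded_incl_eq_1_iff fsD)
  show ?thesis
    unfolding open_system_def
  proof (unfold_locales, simp_all only: gframe.select_convs gsystem.select_convs)
    show "?O \<noteq> {}"
      using closed(1) by blast
  next
    fix U V
    assume U: "U \<in> ?O" and V: "V \<in> ?O"
    show "graded_incl ?X U V \<in> {0..1}"
      using V by (intro graded_incl_range fsD)
    show "graded_incl ?X (fuzzy_Int ?X U V) U = 1" "graded_incl ?X (fuzzy_Int ?X U V) V = 1"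
      unfolding below[OF closed(2)[OF U V] U] below[OF closed(2)[OF U V] V]
      by (simp_all add: fuzzy_Int_def)
    assume "graded_incl ?X U V = 1" "graded_incl ?X V U = 1"
    then have "\<forall>x\<in>?X. U x = V x"
      by (simp add: below U V antisym)
    then show "U = V"
      using U V by (intro fuzzy_set_eqI[of U ?X V] fsD) simp_all
  next
    fix U V W
    assume V: "V \<in> ?O" and W: "W \<in> ?O"
    show "min (graded_incl ?X U V) (graded_incl ?X V W) \<le> graded_incl ?X U W"
      by (rule graded_incl_trans[OF fsD[OF V] fsD[OF W]])
    show "min (graded_incl ?X U V) (graded_incl ?X U W) = graded_incl ?X U (fuzzy_Int ?X V W)"
      by (rule graded_incl_Int[OF fsD[OF V] fsD[OF W]])
  next
    fix \<T> U
    assume \<T>: "\<T> \<subseteq> ?O" and U: "U \<in> \<T>"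
    have "U x \<le> fuzzy_Union ?X \<T> x" if x: "x \<in> ?X" for x
      using sup01_upper[OF fuzzy_sets_range[OF fs_sub[OF \<T>] x] imageI[OF U]] x
      by (simp add: fuzzy_Union_def)
    then show "graded_incl ?X U (fuzzy_Union ?X \<T>) = 1"
      unfolding below[OF subsetD[OF \<T> U] closed(3)[OF \<T>]] by blast
  next
    fix \<T> V
    assume "\<T> \<subseteq> ?O" "V \<in> ?O"
    then show "inf01 {graded_incl ?X U V |U. U \<in> \<T>} = graded_incl ?X (fuzzy_Union ?X \<T>) V"
      by (intro graded_incl_Union fs_sub fsD)
  next
    fix U \<T>
    assume U: "U \<in> ?O" and \<T>: "\<T> \<subseteq> ?O"
    have "{fuzzy_Int ?X U V |V. V \<in> \<T>} \<subseteq> ?O"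
      using U \<T> closed(2) by blast
    note le_iff = below[OF closed(2)[OF U closed(3)[OF \<T>]] closed(3)[OF this]]
    show "graded_incl ?X (fuzzy_Int ?X U (fuzzy_Union ?X \<T>))
        (fuzzy_Union ?X {fuzzy_Int ?X U V |V. V \<in> \<T>}) = 1"
      unfolding le_iff by (intro ballI fuzzy_Int_Union_le fsD[OF U] fs_sub[OF \<T>])
  next
    fix U
    assume U: "U \<in> ?O"
    then show "graded_incl ?X U U = 1"
      by (simp add: below)
    show "graded_incl ?X U (fuzzy_const ?X 1) = 1"
      unfolding below[OF U closed(1)] using fuzzy_set_range[OF fsD[OF U]]
      by (simp add: fuzzy_const_def)
  qed (rule closed; assumption)+
qed

lemma gsystem_laws_open_system:
  assumes T: "fuzzy_space T"
  shows "gsystem_laws (open_system T)"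
proof (rule gsystem_lawsI)
  show "graded_frame (frm (open_system T))"
    using T by (rule graded_frame_opens)
  fix x
  assume "x \<in> spoints (open_system T)"
  then have x: "x \<in> points T"
    by (simp add: open_system_def)
  show "sat (open_system T) x (tp (frm (open_system T))) = 1"
    using x by (simp add: open_system_def fuzzy_const_def)
  show "sat (open_system T) x (Join (frm (open_system T)) S) = sup01 (sat (open_system T) x ` S)"
    for S
    using x by (simp add: open_system_def fuzzy_Union_def)
  fix U V
  show "sat (open_system T) x (meet (frm (open_system T)) U V)
      = min (sat (open_system T) x U) (sat (open_system T) x V)"
    using x by (simp add: open_system_def fuzzy_Int_def)
  assume "V \<in> car (frm (open_system T))"
  then have V: "V \<in> fuzzy_sets (points T)"
    using fuzzy_spaceD(1)[OF T] by (simp add: open_system_def)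
  show "sat (open_system T) x V \<in> {0..1}"
    using fuzzy_set_range[OF V x] by (simp add: open_system_def)
  show "min (sat (open_system T) x U) (rel (frm (open_system T)) U V) \<le> sat (open_system T) x V"
    using min_graded_incl_le[OF V x, of U]
    by (simp only: open_system_def gsystem.select_convs gframe.select_convs)
qed

section \<open>Renaming the frame of a system\<close>

lemma graded_frame_rename:
  assumes e: "inj e" and "graded_frame (frm Q)"
  shows "graded_frame (frm (rename_frame e Q))"
proof -
  interpret graded_frame "frm Q" by fact
  let ?A = "car (frm Q)"
  have inv_e: "inv e (e a) = a" for a
    using e by simp
  have inv_image: "inv e ` S \<subseteq> ?A" if "S \<subseteq> e ` ?A" for S
    using that by (auto simp: inv_e)
  have setcomp: "{F (inv e a) |a. a \<in> S} = {F a |a. a \<in> inv e ` S}" for S and F :: "'a \<Rightarrow> 'd"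
    by blast
  show ?thesis
    unfolding rename_frame_def
  proof (unfold_locales, simp_all only: gframe.select_convs gsystem.select_convs)
    fix S b
    assume "S \<subseteq> e ` ?A" "b \<in> e ` ?A"
    then show "inf01 {rel (frm Q) (inv e a) (inv e b) |a. a \<in> S}
        = rel (frm Q) (inv e (e (Join (frm Q) (inv e ` S)))) (inv e b)"
      using rel_Join[OF inv_image, of S "inv e b"]
      by (auto simp: inv_e setcomp[of "\<lambda>a. rel (frm Q) a (inv e b)"])
  next
    fix S a
    assume S: "S \<subseteq> e ` ?A" "a \<in> e ` ?A"
    have "inv e ` {e (meet (frm Q) (inv e a) (inv e b)) |b. b \<in> S}
        = {meet (frm Q) (inv e a) b |b. b \<in> inv e ` S}"
      by (auto simp: inv_e image_iff Bex_def) (metis inv_e)+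
    then show "rel (frm Q) (inv e (e (meet (frm Q) (inv e a) (inv e (e (Join (frm Q) (inv e ` S)))))))
        (inv e (e (Join (frm Q) (inv e ` {e (meet (frm Q) (inv e a) (inv e b)) |b. b \<in> S})))) = 1"
      using distrib[OF _ inv_image, of "inv e a" S] S by (auto simp: inv_e)
  next
    fix S a
    assume "S \<subseteq> e ` ?A" "a \<in> S"
    then show "rel (frm Q) (inv e a) (inv e (e (Join (frm Q) (inv e ` S)))) = 1"
      using Join_upper[OF inv_image, of S "inv e a"] by (simp add: inv_e)
  next
    fix S
    assume "S \<subseteq> e ` ?A"
    then show "e (Join (frm Q) (inv e ` S)) \<in> e ` ?A"
      using Join_closed[OF inv_image] by blast
  qed (auto simp: inv_e nonempty top_closed meet_closed rel_refl rel_top meet_lower1 meet_lower2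
      rel_meet intro: rel_trans arg_cong[where f = e, OF rel_antisym] dest: rel_range)
qed

lemma gsystem_laws_rename:
  assumes e: "inj e" and Q: "gsystem_laws Q"
  shows "gsystem_laws (rename_frame e Q)"
proof (rule gsystem_lawsI)
  show "graded_frame (frm (rename_frame e Q))"
    using e gsystem_frame[OF Q] by (rule graded_frame_rename)
next
  fix x S
  assume x: "x \<in> spoints (rename_frame e Q)" and S: "S \<subseteq> car (frm (rename_frame e Q))"
  have "inv e ` S \<subseteq> car (frm Q)"
    using S e by (auto simp: rename_frame_def)
  then show "sat (rename_frame e Q) x (Join (frm (rename_frame e Q)) S)
      = sup01 (sat (rename_frame e Q) x ` S)"
    using x e sat_Join[OF Q] by (simp add: rename_frame_def image_image)
qed (use e sat_range[OF Q] in
    \<open>auto simp: rename_frame_def sat_rel[OF Q] sat_meet[OF Q] sat_top[OF Q]\<close>)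

section \<open>The two categories\<close>

lemma compose_restrict_id:
  "f \<in> X \<rightarrow>\<^sub>E Y \<Longrightarrow> compose X f (\<lambda>x\<in>X. x) = f"
  "f \<in> X \<rightarrow>\<^sub>E Y \<Longrightarrow> compose X (\<lambda>y\<in>Y. y) f = f"
  by (auto simp: compose_def fun_eq_iff PiE_def extensional_def Pi_def)

lemma compose_PiE: "f \<in> X \<rightarrow>\<^sub>E Y \<Longrightarrow> g \<in> Y \<rightarrow>\<^sub>E Z \<Longrightarrow> compose X g f \<in> X \<rightarrow>\<^sub>E Z"
  by (auto simp: compose_def dest: PiE_mem)

lemma compose_compose:
  "f \<in> X \<rightarrow>\<^sub>E Y \<Longrightarrow> compose X h (compose X g f) = compose X (compose Y h g) f"
  by (auto simp: compose_def fun_eq_iff dest: PiE_mem)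

lemma fuzzy_continuousD:
  assumes "f \<in> fuzzy_continuous S T"
  shows "f \<in> points S \<rightarrow>\<^sub>E points T" "V \<in> opens T \<Longrightarrow> preimg (points S) f V \<in> opens S"
  using assms by (simp_all add: fuzzy_continuous_def)

lemma category_top_cat:
  fixes P :: "'x fspace \<Rightarrow> bool"
  shows "category (top_cat P)"
proof
  fix T :: "'x fspace"
  assume "T \<in> Ob (top_cat P)"
  then show "Id (top_cat P) T \<in> Hom (top_cat P) T T"
    using fuzzy_spaceD(1)[of T] by (auto simp: top_cat_def fuzzy_continuous_def preimg_id)
next
  fix S T U :: "'x fspace" and f g
  assume "f \<in> Hom (top_cat P) S T" "g \<in> Hom (top_cat P) T U"
  then have f: "f \<in> fuzzy_continuous S T" and g: "g \<in> fuzzy_continuous T U"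
    by (simp_all add: top_cat_def)
  note maps = fuzzy_continuousD(1)[OF f] fuzzy_continuousD(1)[OF g]
  have "preimg (points S) (compose (points S) g f) V \<in> opens S" if "V \<in> opens U" for V
    unfolding preimg_compose[OF maps(1)]
    by (rule fuzzy_continuousD(2)[OF f fuzzy_continuousD(2)[OF g that]])
  then have "compose (points S) g f \<in> fuzzy_continuous S U"
    using compose_PiE[OF maps] by (simp add: fuzzy_continuous_def)
  then show "Comp (top_cat P) S T U g f \<in> Hom (top_cat P) S U"
    by (simp add: top_cat_def)
next
  fix S T :: "'x fspace" and f
  assume "f \<in> Hom (top_cat P) S T"
  then have f: "f \<in> points S \<rightarrow>\<^sub>E points T"
    by (simp add: top_cat_def fuzzy_continuous_def)
  then show "Comp (top_cat P) S S T f (Id (top_cat P) S) = f"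
    "Comp (top_cat P) S T T (Id (top_cat P) T) f = f"
    by (simp_all add: top_cat_def compose_restrict_id)
next
  fix R S T U :: "'x fspace" and f g h
  assume "f \<in> Hom (top_cat P) R S"
  then have "f \<in> points R \<rightarrow>\<^sub>E points S"
    by (simp add: top_cat_def fuzzy_continuous_def)
  then show "Comp (top_cat P) R T U h (Comp (top_cat P) R S T g f)
      = Comp (top_cat P) R S U (Comp (top_cat P) S T U h g) f"
    by (simp add: top_cat_def compose_compose)
qed

lemma gframe_homD:
  assumes "f \<in> gframe_hom A B"
  shows "f \<in> car A \<rightarrow>\<^sub>E car B"
    and "a \<in> car A \<Longrightarrow> b \<in> car A \<Longrightarrow> f (meet A a b) = meet B (f a) (f b)"
    and "S \<subseteq> car A \<Longrightarrow> f (Join A S) = Join B (f ` S)"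
    and "a \<in> car A \<Longrightarrow> b \<in> car A \<Longrightarrow> rel A a b \<le> rel B (f a) (f b)"
  using assms by (simp_all add: gframe_hom_def)

lemma gframe_hom_id:
  assumes "graded_frame A"
  shows "(\<lambda>a\<in>car A. a) \<in> gframe_hom A A"
proof -
  interpret graded_frame A by fact
  have "(\<lambda>a\<in>car A. a) ` S = S" if "S \<subseteq> car A" for S
    using that by force
  then show ?thesis
    by (simp add: gframe_hom_def meet_closed Join_closed)
qed

lemma gframe_hom_compose:
  assumes "graded_frame A" and f: "f \<in> gframe_hom A B" and g: "g \<in> gframe_hom B C"
  shows "compose (car A) g f \<in> gframe_hom A C"
proof -
  interpret graded_frame A by fact
  have f_in: "f a \<in> car B" if "a \<in> car A" for a
    using gframe_homD(1)[OF f] that by (rule PiE_mem)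
  have g_in: "g b \<in> car C" if "b \<in> car B" for b
    using gframe_homD(1)[OF g] that by (rule PiE_mem)
  have "compose (car A) g f (Join A S) = Join C (compose (car A) g f ` S)" if S: "S \<subseteq> car A" for S
  proof -
    have "f ` S \<subseteq> car B"
      using S f_in by blast
    then have "g (f (Join A S)) = Join C (g ` f ` S)"
      using gframe_homD(3)[OF f S] gframe_homD(3)[OF g] by simp
    moreover have "compose (car A) g f ` S = g ` f ` S"
      using S by (force simp: compose_def)
    ultimately show ?thesis
      using S by (simp add: compose_def Join_closed)
  qed
  moreover have "rel A a b \<le> rel C (g (f a)) (g (f b))" if "a \<in> car A" "b \<in> car A" for a b
    using gframe_homD(4)[OF f that] gframe_homD(4)[OF g f_in f_in] that by fastforce
  ultimately show ?thesis
    by (auto simp: gframe_hom_def compose_def f_in g_in meet_closed gframe_homD(2)[OF f]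
        gframe_homD(2)[OF g])
qed

lemma gsystem_homD:
  assumes "f \<in> gsystem_hom P Q"
  shows "fst f \<in> spoints P \<rightarrow>\<^sub>E spoints Q"
    and "snd f \<in> gframe_hom (frm Q) (frm P)"
    and "x \<in> spoints P \<Longrightarrow> b \<in> car (frm Q) \<Longrightarrow> sat P x (snd f b) = sat Q (fst f x) b"
  using assms by (auto simp: gsystem_hom_def)

lemma gsystem_homI:
  assumes "fst f \<in> spoints P \<rightarrow>\<^sub>E spoints Q"
    and "snd f \<in> gframe_hom (frm Q) (frm P)"
    and "\<And>x b. x \<in> spoints P \<Longrightarrow> b \<in> car (frm Q) \<Longrightarrow> sat P x (snd f b) = sat Q (fst f x) b"
  shows "f \<in> gsystem_hom P Q"
  using assms by (auto simp: gsystem_hom_def split: prod.splits)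

lemma category_topsys_cat:
  fixes P :: "('x, 'a) gsystem \<Rightarrow> bool"
  shows "category (topsys_cat P)"
proof
  fix Q :: "('x, 'a) gsystem"
  assume "Q \<in> Ob (topsys_cat P)"
  then show "Id (topsys_cat P) Q \<in> Hom (topsys_cat P) Q Q"
    by (auto simp: topsys_cat_def intro!: gsystem_homI gframe_hom_id gsystem_frame)
next
  fix Q R S :: "('x, 'a) gsystem" and f g
  assume Ob: "Q \<in> Ob (topsys_cat P)" "R \<in> Ob (topsys_cat P)" "S \<in> Ob (topsys_cat P)"
    and Hom: "f \<in> Hom (topsys_cat P) Q R" "g \<in> Hom (topsys_cat P) R S"
  have f: "f \<in> gsystem_hom Q R" and g: "g \<in> gsystem_hom R S" and S: "gsystem_laws S"
    using Ob Hom by (simp_all add: topsys_cat_def)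
  have "Comp (topsys_cat P) Q R S g f \<in> gsystem_hom Q S"
  proof (rule gsystem_homI)
    show "fst (Comp (topsys_cat P) Q R S g f) \<in> spoints Q \<rightarrow>\<^sub>E spoints S"
      using gsystem_homD(1)[OF f] gsystem_homD(1)[OF g]
      by (simp add: topsys_cat_def compose_PiE)
    show "snd (Comp (topsys_cat P) Q R S g f) \<in> gframe_hom (frm S) (frm Q)"
      using gframe_hom_compose[OF gsystem_frame[OF S] gsystem_homD(2)[OF g] gsystem_homD(2)[OF f]]
      by (simp add: topsys_cat_def)
    fix x b
    assume x: "x \<in> spoints Q" and b: "b \<in> car (frm S)"
    have "fst f x \<in> spoints R" "snd g b \<in> car (frm R)"
      using PiE_mem[OF gsystem_homD(1)[OF f] x]
        PiE_mem[OF gframe_homD(1)[OF gsystem_homD(2)[OF g]] b] by auto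
    then show "sat Q x (snd (Comp (topsys_cat P) Q R S g f) b)
        = sat S (fst (Comp (topsys_cat P) Q R S g f) x) b"
      using x b gsystem_homD(3)[OF f x] gsystem_homD(3)[OF g]
      by (simp add: topsys_cat_def compose_def)
  qed
  then show "Comp (topsys_cat P) Q R S g f \<in> Hom (topsys_cat P) Q S"
    by (simp add: topsys_cat_def)
next
  fix Q R :: "('x, 'a) gsystem" and f
  assume "f \<in> Hom (topsys_cat P) Q R"
  then have "f \<in> gsystem_hom Q R"
    by (simp add: topsys_cat_def)
  note f = gsystem_homD(1)[OF this] gframe_homD(1)[OF gsystem_homD(2)[OF this]]
  show "Comp (topsys_cat P) Q Q R f (Id (topsys_cat P) Q) = f"
    "Comp (topsys_cat P) Q R R (Id (topsys_cat P) R) f = f"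
    using f by (simp_all add: topsys_cat_def compose_restrict_id)
next
  fix Q R S T :: "('x, 'a) gsystem" and f g h
  assume "f \<in> Hom (topsys_cat P) Q R" "h \<in> Hom (topsys_cat P) S T"
  then have f: "f \<in> gsystem_hom Q R" and h: "h \<in> gsystem_hom S T"
    by (simp_all add: topsys_cat_def)
  show "Comp (topsys_cat P) Q S T h (Comp (topsys_cat P) Q R S g f)
      = Comp (topsys_cat P) Q R T (Comp (topsys_cat P) R S T h g) f"
    using gsystem_homD(1)[OF f] gframe_homD(1)[OF gsystem_homD(2)[OF h]]
    by (simp add: topsys_cat_def compose_compose)
qed

section \<open>Morphisms out of the system of fuzzy open sets\<close>

lemma frm_J_g:
  "frm (obj (J_g e) T) =
    \<lparr>car = e ` opens T,
     tp = e (fuzzy_const (points T) 1),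
     meet = (\<lambda>a b. e (fuzzy_Int (points T) (inv e a) (inv e b))),
     Join = (\<lambda>S. e (fuzzy_Union (points T) (inv e ` S))),
     rel = (\<lambda>a b. graded_incl (points T) (inv e a) (inv e b))\<rparr>"
  by (simp add: J_g_def rename_frame_def open_system_def)

lemma spoints_J_g: "spoints (obj (J_g e) T) = points T"
  by (simp add: J_g_def rename_frame_def open_system_def)

lemma sat_J_g: "sat (obj (J_g e) T) x a = inv e a x"
  by (simp add: J_g_def rename_frame_def open_system_def)

lemma Ext_g_simps:
  "points (obj Ext_g Q) = spoints Q"
  "opens (obj Ext_g Q) = ext Q ` car (frm Q)"
  by (simp_all add: Ext_g_def)

lemma gsystem_laws_J_g: "inj e \<Longrightarrow> fuzzy_space T \<Longrightarrow> gsystem_laws (obj (J_g e) T)"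
  by (simp add: J_g_def gsystem_laws_rename gsystem_laws_open_system)

text \<open>Extents turn meets and joins into pointwise minima and suprema, and their
  inclusion has at least the grade of the frame relation; preimages
  commute with minima and suprema and do not lower grades of inclusion.\<close>

lemma preimg_ext_gframe_hom:
  assumes e: "inj e" and Q: "gsystem_laws Q"
    and f: "f \<in> fuzzy_continuous S (obj Ext_g Q)"
  shows "(\<lambda>b\<in>car (frm Q). e (preimg (points S) f (ext Q b)))
    \<in> gframe_hom (frm Q) (frm (obj (J_g e) S))"
    (is "?h \<in> _")
proof -
  interpret graded_frame "frm Q"
    using Q by (rule gsystem_frame)
  let ?X = "points S"
  have f_in: "f \<in> ?X \<rightarrow>\<^sub>E spoints Q"
    and open_preimg: "\<And>b. b \<in> car (frm Q) \<Longrightarrow> preimg ?X f (ext Q b) \<in> opens S"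
    using fuzzy_continuousD[OF f] by (simp_all add: Ext_g_simps)
  have inv_e: "inv e (e V) = V" for V
    using e by simp
  have "?h (Join (frm Q) B) = Join (frm (obj (J_g e) S)) (?h ` B)" if B: "B \<subseteq> car (frm Q)" for B
  proof -
    have "inv e ` ?h ` B = preimg ?X f ` ext Q ` B"
      unfolding image_image using B by (intro image_cong) (auto simp: inv_e)
    then show ?thesis
      using B by (simp add: frm_J_g Join_closed ext_Join[OF Q] preimg_Union[OF f_in])
  qed
  moreover have "rel (frm Q) a b \<le> graded_incl ?X (preimg ?X f (ext Q a)) (preimg ?X f (ext Q b))"
    if "a \<in> car (frm Q)" "b \<in> car (frm Q)" for a b
    using rel_le_graded_incl_ext[OF Q that]
      graded_incl_le_preimg[OF f_in ext_in[OF Q that(2)], of "ext Q a"] by linarith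
  ultimately show ?thesis
    by (auto simp: gframe_hom_def frm_J_g inv_e open_preimg meet_closed ext_meet[OF Q]
        preimg_Int[OF f_in])
qed

text \<open>A fuzzy open set of \<open>S\<close> is determined by its values at points, so compatibility leaves one
  choice for \<open>f2\<close>; this choice takes values in the frame of \<open>J\<^sub>g S\<close> exactly if \<open>f1\<close> is
  continuous.\<close>

lemma hom_from_J_g_iff:
  assumes e: "inj e" and S: "fuzzy_space S" and Q: "gsystem_laws Q"
  shows "(f1, f2) \<in> gsystem_hom (obj (J_g e) S) Q \<longleftrightarrow>
    f1 \<in> fuzzy_continuous S (obj Ext_g Q) \<and>
    f2 = (\<lambda>b\<in>car (frm Q). e (preimg (points S) f1 (ext Q b)))"
proof -
  let ?X = "points S" and ?B = "car (frm Q)"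
  have inv_e: "inv e (e V) = V" for V
    using e by simp
  show ?thesis
  proof
    assume f: "(f1, f2) \<in> gsystem_hom (obj (J_g e) S) Q"
    have f1: "f1 \<in> ?X \<rightarrow>\<^sub>E spoints Q"
      using gsystem_homD(1)[OF f] by (simp add: spoints_J_g)
    have f2: "f2 \<in> ?B \<rightarrow>\<^sub>E e ` opens S"
      using gframe_homD(1)[OF gsystem_homD(2)[OF f]] by (simp add: frm_J_g)
    have forced: "preimg ?X f1 (ext Q b) \<in> opens S \<and> f2 b = e (preimg ?X f1 (ext Q b))"
      if b: "b \<in> ?B" for b
    proof -
      from PiE_mem[OF f2 b] obtain V where V: "V \<in> opens S" "f2 b = e V" by auto
      have "V x = preimg ?X f1 (ext Q b) x" if "x \<in> ?X" for x
        using gsystem_homD(3)[OF f _ b, of x] PiE_mem[OF f1 that] that V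
        by (simp add: spoints_J_g sat_J_g inv_e preimg_def ext_def)
      then have "V = preimg ?X f1 (ext Q b)"
        using fuzzy_spaceD(1)[OF S V(1)] preimg_in[OF f1 ext_in[OF Q b]] by (intro fuzzy_set_eqI)
      then show ?thesis
        using V by simp
    qed
    moreover have "f2 = (\<lambda>b\<in>?B. e (preimg ?X f1 (ext Q b)))"
      using f2 forced by (auto simp: fun_eq_iff PiE_def extensional_def)
    ultimately show "f1 \<in> fuzzy_continuous S (obj Ext_g Q) \<and>
        f2 = (\<lambda>b\<in>?B. e (preimg ?X f1 (ext Q b)))"
      using f1 by (auto simp: fuzzy_continuous_def Ext_g_simps)
  next
    assume f: "f1 \<in> fuzzy_continuous S (obj Ext_g Q) \<and>
        f2 = (\<lambda>b\<in>?B. e (preimg ?X f1 (ext Q b)))"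
    then have "f1 \<in> ?X \<rightarrow>\<^sub>E spoints Q"
      using fuzzy_continuousD(1)[of f1 S "obj Ext_g Q"] by (simp add: Ext_g_simps)
    then show "(f1, f2) \<in> gsystem_hom (obj (J_g e) S) Q"
      using f preimg_ext_gframe_hom[OF e Q]
      by (intro gsystem_homI)
        (auto simp: spoints_J_g sat_J_g inv_e preimg_def ext_def dest: PiE_mem)
  qed
qed

text \<open>Every fuzzy open set of \<open>T\<close> is its own extent, so the unit of the adjunction is an identity at
  each space.\<close>

lemma ext_J_g:
  assumes "inj e" "V \<in> fuzzy_sets (points T)"
  shows "ext (obj (J_g e) T) (e V) = V"
  using assms by (auto simp: ext_def spoints_J_g sat_J_g fun_eq_iff PiE_def extensional_def)

lemma Ext_g_J_g:
  assumes "inj e" "fuzzy_space T"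
  shows "obj Ext_g (obj (J_g e) T) = T"
proof (rule fspace.equality)
  show "opens (obj Ext_g (obj (J_g e) T)) = opens T"
    using ext_J_g[OF assms(1) fuzzy_spaceD(1)[OF assms(2)]]
    by (simp add: Ext_g_simps frm_J_g image_image)
qed (simp_all add: Ext_g_simps spoints_J_g)

section \<open>The functors and the adjunction\<close>

lemma is_functor_J_g:
  fixes e :: "('x \<Rightarrow> real) \<Rightarrow> 'a" and p :: "'x set \<Rightarrow> bool"
  assumes e: "inj e"
  shows "is_functor (top_cat (\<lambda>T. p (points T))) (topsys_cat (\<lambda>Q. p (spoints Q))) (J_g e)"
    (is "is_functor ?C ?D _")
proof -
  have inv_e: "inv e (e V) = V" for V
    using e by simp
  have arr: "arr (J_g e) S T f = (f, \<lambda>b\<in>e ` opens T. e (preimg (points S) f (inv e b)))" for S T f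
    by (simp add: J_g_def)
  show ?thesis
  proof (intro is_functor.intro is_functor_axioms.intro category_top_cat category_topsys_cat)
    fix T
    assume "T \<in> Ob ?C"
    then show "obj (J_g e) T \<in> Ob ?D"
      by (simp add: top_cat_def topsys_cat_def gsystem_laws_J_g[OF e] spoints_J_g)
  next
    fix S T f
    assume "S \<in> Ob ?C" "T \<in> Ob ?C" "f \<in> Hom ?C S T"
    then have S: "fuzzy_space S" and T: "fuzzy_space T" and f: "f \<in> fuzzy_continuous S T"
      by (simp_all add: top_cat_def)
    have "(\<lambda>b\<in>e ` opens T. e (preimg (points S) f (inv e b)))
        = (\<lambda>b\<in>car (frm (obj (J_g e) T)). e (preimg (points S) f (ext (obj (J_g e) T) b)))"
      by (rule ext) (auto simp: frm_J_g ext_J_g[OF e fuzzy_spaceD(1)[OF T]] inv_e)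
    \<comment> \<open>Since \<open>Ext\<^sub>g (J\<^sub>g T) = T\<close>, this is the morphism that corresponds to \<open>f\<close> itself.\<close>
    then have "arr (J_g e) S T f \<in> gsystem_hom (obj (J_g e) S) (obj (J_g e) T)"
      using f unfolding arr hom_from_J_g_iff[OF e S gsystem_laws_J_g[OF e T]] Ext_g_J_g[OF e T]
      by simp
    then show "arr (J_g e) S T f \<in> Hom ?D (obj (J_g e) S) (obj (J_g e) T)"
      by (simp add: topsys_cat_def)
  next
    fix T
    assume "T \<in> Ob ?C"
    then show "arr (J_g e) T T (Id ?C T) = Id ?D (obj (J_g e) T)"
      using fuzzy_spaceD(1)[of T]
      by (auto simp: arr top_cat_def topsys_cat_def spoints_J_g frm_J_g inv_e preimg_id fun_eq_iff)
  next
    fix S T U f g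
    assume f: "f \<in> Hom ?C S T" and g: "g \<in> Hom ?C T U"
    show "arr (J_g e) S U (Comp ?C S T U g f)
        = Comp ?D (obj (J_g e) S) (obj (J_g e) T) (obj (J_g e) U)
            (arr (J_g e) T U g) (arr (J_g e) S T f)"
      using f g
      by (auto simp: arr top_cat_def topsys_cat_def spoints_J_g frm_J_g inv_e fun_eq_iff compose_def
          preimg_compose[unfolded compose_def] fuzzy_continuous_def)
  qed
qed

lemma is_functor_Ext_g:
  fixes p :: "'x set \<Rightarrow> bool"
  shows "is_functor (topsys_cat (\<lambda>Q. p (spoints Q))) (top_cat (\<lambda>T. p (points T)))
    (Ext_g :: (('x, 'a) gsystem, _, _, _) func)"
    (is "is_functor ?D ?C _")
proof (intro is_functor.intro is_functor_axioms.intro category_top_cat category_topsys_cat)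
  fix Q :: "('x, 'a) gsystem"
  assume "Q \<in> Ob ?D"
  then show "obj Ext_g Q \<in> Ob ?C"
    using fuzzy_space_Ext[of Q] by (simp add: top_cat_def topsys_cat_def Ext_g_def)
next
  fix P Q :: "('x, 'a) gsystem" and f
  assume "f \<in> Hom ?D P Q"
  then have f: "f \<in> gsystem_hom P Q"
    by (simp add: topsys_cat_def)
  note f1 = gsystem_homD(1)[OF f]
  \<comment> \<open>The compatibility condition of a morphism says that preimages of extents are extents.\<close>
  have "preimg (spoints P) (fst f) (ext Q b) = ext P (snd f b)" if "b \<in> car (frm Q)" for b
    using gsystem_homD(3)[OF f _ that] PiE_mem[OF f1]
    by (auto simp: preimg_def ext_def fun_eq_iff)
  moreover have "snd f b \<in> car (frm P)" if "b \<in> car (frm Q)" for b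
    using gframe_homD(1)[OF gsystem_homD(2)[OF f]] that by (rule PiE_mem)
  ultimately have "fst f \<in> fuzzy_continuous (obj Ext_g P) (obj Ext_g Q)"
    using f1 by (auto simp: fuzzy_continuous_def Ext_g_simps)
  then show "arr Ext_g P Q f \<in> Hom ?C (obj Ext_g P) (obj Ext_g Q)"
    by (simp add: top_cat_def Ext_g_def)
qed (simp_all add: top_cat_def topsys_cat_def Ext_g_def)

lemma right_adjoint_Ext_g_J_g:
  fixes e :: "('x \<Rightarrow> real) \<Rightarrow> 'a" and p :: "'x set \<Rightarrow> bool"
  assumes e: "inj e"
  shows "right_adjoint (top_cat (\<lambda>T. p (points T))) (topsys_cat (\<lambda>Q. p (spoints Q))) (J_g e) Ext_g"
    (is "right_adjoint ?C ?D _ _")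
  unfolding right_adjoint_def
proof (intro exI adjunction.intro adjunction_axioms.intro is_functor_J_g[OF e] is_functor_Ext_g)
  let ?\<phi> = "\<lambda>(_ :: 'x fspace) (_ :: ('x, 'a) gsystem) (f :: ('x \<Rightarrow> 'x) \<times> ('a \<Rightarrow> 'a)). fst f"
  fix S Q
  assume "S \<in> Ob ?C" "Q \<in> Ob ?D"
  then have S: "fuzzy_space S" and Q: "gsystem_laws Q"
    by (simp_all add: top_cat_def topsys_cat_def)
  note iff = hom_from_J_g_iff[OF e S Q]
  have "bij_betw fst (gsystem_hom (obj (J_g e) S) Q) (fuzzy_continuous S (obj Ext_g Q))"
    by (rule bij_betwI[where g = "\<lambda>f. (f, \<lambda>b\<in>car (frm Q). e (preimg (points S) f (ext Q b)))"])
      (auto simp: iff)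
  then show "bij_betw (?\<phi> S Q) (Hom ?D (obj (J_g e) S) Q) (Hom ?C S (obj Ext_g Q))"
    by (simp add: top_cat_def topsys_cat_def)
qed (simp_all add: top_cat_def topsys_cat_def J_g_def Ext_g_def rename_frame_def open_system_def)

theorem lemma7p2p7:
  fixes e :: "('x \<Rightarrow> real) \<Rightarrow> 'a"
  assumes "inj e"
  shows "right_adjoint Graded_Fuzzy_Top_nonempty Graded_Fuzzy_TopSys (J_g e) Ext_g \<and>
    right_adjoint Graded_Fuzzy_Top Graded_Fuzzy_TopSys_with_empty (J_g e) Ext_g"
  unfolding Graded_Fuzzy_Top_nonempty_def Graded_Fuzzy_TopSys_def Graded_Fuzzy_Top_def
    Graded_Fuzzy_TopSys_with_empty_def
  using right_adjoint_Ext_g_J_g[OF assms, of "\<lambda>X. X \<noteq> {}"]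
    right_adjoint_Ext_g_J_g[OF assms, of "\<lambda>_. True"]
  by simp

end
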